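(* Let $a_1$ be a nonzero integer and $f := X^2 - a_1X - 1$. Then $\mathcal{R}(f) = \mathbb{Z}^+$; that is, for every integer $n \ge 1$ there exist $\bm{x} \in \mathcal{L}(f)$ and an integer $m \ge 1$ such that $\rho(\bm{x}; m) = n$. Moreover, for a given $n \ge 1$, one can choose such $\bm{x}$ and $m$ so that additionally $x_j \not\equiv 0 \pmod m$ for every $j \ge 0$ if and only if either $|a_1| = 1$ and $n \ge 4$, or $|a_1| \ge 2$.
   Context: For a monic polynomial $f = X^k - a_1X^{k-1} - \cdots - a_k \in \mathbb{Z}[X]$, $\mathcal{L}(f)$ denotes the set of integer sequences $\bm{x} = (x_n)_{n\ge 0}$ satisfying $x_n = a_1x_{n-1} + \cdots + a_kx_{n-k}$ for all $n \ge k$. For $\bm{x}$ an integer sequence and an integer $m \ge 1$, $\rho(\bm{x}; m) := \#\{x_n \bmod m : n \ge 0\}$ is the number of distinct residues of $\bm{x}$ modulo $m$. Finally $\mathcal{R}(f) := \{\rho(\bm{x}; m) : \bm{x} \in \mathcal{L}(f),\ m \in \mathbb{Z}^+\}$. *)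

theory Defs
  imports "HOL-Computational_Algebra.Polynomial"
begin

text \<open>For a monic f = X^k - a_1 X^(k-1) - ... - a_k, with k = degree f, we have
  a_i = - coeff f (k - i).  L(f) is the set of integer sequences satisfying the recurrence.\<close>
definition LRS :: "int poly \<Rightarrow> (nat \<Rightarrow> int) set" where
  "LRS f = {x. \<forall>n\<ge>degree f. x n = (\<Sum>i=1..degree f. (- coeff f (degree f - i)) * x (n - i))}"

definition rho :: "(nat \<Rightarrow> int) \<Rightarrow> int \<Rightarrow> nat" where
  "rho x m = card ((\<lambda>n. x n mod m) ` UNIV)"

definition Rset :: "int poly \<Rightarrow> nat set" where
  "Rset f = {rho x m | x m. x \<in> LRS f \<and> m \<ge> 1}"

end

theory Submission
  imports Defs "HOL-Number_Theory.Cong"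
begin

text \<open>
  Write b = |a_1|, and let U and V be the Lucas sequences of X^2 - b X - 1 with initial values
  0, 1 and 2, b. If x satisfies the recurrence for b then (-1)^j x_j satisfies it for -b, so only
  b matters up to signs. Apart from a few small cases, the residue counts come from three families,
  all of which avoid 0 because every residue is represented by +v or -v with 0 < v < m / 2.

  \<^item> h odd, m = V_h, x_j = U_(j+h) + e U_j with e = 1 or -1. Then x_(j+h) = e x_j modulo m, and for
    j < h the residue of x_j is, up to sign, U_j + U_(h-j) or U_j - U_(h-j); these h absolute values
    are distinct. So there are h residues, or 2 h when the antiperiod yields both signs.
  \<^item> h odd, b \<noteq> 2, m = (b^2 + 4) U_h, x_j = V_j. The residues are +-V_0, ..., +-V_h, which
    makes 2 (h + 1) of them. For b = 2 this fails since V_0 = V_1.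
  \<^item> b = 2, h odd, m = 2 U_h, x_j = V_j / 2 + U_h U_j. The second summand only alters x_j at odd j
    and separates the two coinciding terms, giving 2 (h + 1) residues again.

  Together these cover all n modulo 4. If b = 1 and 0 is avoided then three consecutive terms (from
  the second term on) are distinct modulo m, so with at most three residues x_(j+3) = x_j; this
  forces 2 x_i = 2 x_(i+1) = 0 for some i, hence x_i = x_(i+1) modulo m, a contradiction.
\<close>

section \<open>Second-order recurrences\<close>

definition binrec :: "int \<Rightarrow> (nat \<Rightarrow> int) \<Rightarrow> bool" where
  "binrec a x \<longleftrightarrow> (\<forall>n. x (Suc (Suc n)) = a * x (Suc n) + x n)"

lemma LRS_iff_binrec: "x \<in> LRS [:-1, -a, 1:] \<longleftrightarrow> binrec a x"
proof -
  have *: "x \<in> LRS [:-1, -a, 1:] \<longleftrightarrow> (\<forall>n\<ge>2. x n = a * x (n - 1) + x (n - 2))"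
    by (simp add: LRS_def numeral_2_eq_2)
  show ?thesis unfolding * binrec_def
  proof (intro iffI allI impI)
    fix n assume "\<forall>n\<ge>2. x n = a * x (n - 1) + x (n - 2)"
    from this[rule_format, of "Suc (Suc n)"] show "x (Suc (Suc n)) = a * x (Suc n) + x n"
      by simp
  next
    fix n :: nat assume H: "\<forall>n. x (Suc (Suc n)) = a * x (Suc n) + x n" and "2 \<le> n"
    then obtain k where "n = Suc (Suc k)" by (metis add_2_eq_Suc le_Suc_ex)
    then show "x n = a * x (n - 1) + x (n - 2)" using H by simp
  qed
qed

lemma binrec_twist:
  assumes "binrec b x" "s * s = 1"
  shows "binrec (s * b) (\<lambda>j. s ^ j * x j)"
proof -
  have "s * (s * t) = t" for t using assms(2) by (metis mult.assoc mult_1)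
  then show ?thesis using assms(1) by (simp add: binrec_def distrib_left mult.left_commute mult.assoc)
qed

section \<open>Lucas sequences: addition and reflection formulas\<close>

fun luc :: "int \<Rightarrow> int \<Rightarrow> int \<Rightarrow> nat \<Rightarrow> int" where
  "luc b c d 0 = c"
| "luc b c d (Suc 0) = d"
| "luc b c d (Suc (Suc n)) = b * luc b c d (Suc n) + luc b c d n"

abbreviation U :: "int \<Rightarrow> nat \<Rightarrow> int" where "U b \<equiv> luc b 0 1"
abbreviation V :: "int \<Rightarrow> nat \<Rightarrow> int" where "V b \<equiv> luc b 2 b"

lemma binrec_luc: "binrec b (luc b c d)"
  by (simp add: binrec_def)

text \<open>The factor \<open>U b (Suc n) - b * U b n\<close> is U_(n-1), written so that it is also
  right at n = 0. The two formulas need each other in the induction.\<close>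

lemma U_add:
  "U b (p + n) = U b p * (U b (Suc n) - b * U b n) + U b (Suc p) * U b n
   \<and> U b (Suc (p + n)) = U b (Suc p) * U b (Suc n) + U b p * U b n"
  by (induction n) (auto simp: algebra_simps)

lemma U_cassini: "U b (Suc n) ^ 2 - b * U b (Suc n) * U b n - U b n ^ 2 = (-1) ^ n"
proof (induction n)
  case (Suc n)
  have "U b (Suc (Suc n)) ^ 2 - b * U b (Suc (Suc n)) * U b (Suc n) - U b (Suc n) ^ 2
      = - (U b (Suc n) ^ 2 - b * U b (Suc n) * U b n - U b n ^ 2)"
    by (simp add: power2_eq_square algebra_simps)
  then show ?case using Suc by simp
qed simp

lemma V_eq: "V b n = 2 * U b (Suc n) - b * U b n"
  by (induction b "0::int" "1::int" n rule: luc.induct) (auto simp: algebra_simps)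

text \<open>Reflection about the index p + q: modulo the accompanying product, the term q places
  after it is the term q places before it, up to sign. The addition formulas reduce each identity to
  one between polynomials in b and four values of U, with (-1)^q replaced by the Cassini
  form.\<close>

lemma U_add_double: "U b (p + 2 * q) = U b q * V b (p + q) + (-1) ^ q * U b p"
  and U_add_double': "U b (p + 2 * q) = V b q * U b (p + q) - (-1) ^ q * U b p"
  and V_add_double: "V b (p + 2 * q) = (b\<^sup>2 + 4) * U b q * U b (p + q) + (-1) ^ q * V b p"
proof -
  define r r' u u' where d: "r = U b p" "r' = U b (Suc p)" "u = U b q" "u' = U b (Suc q)"
  have s: "U b (p + q) = r * (u' - b * u) + r' * u" "U b (Suc (p + q)) = r' * u' + r * u"
    using U_add[of b p q] by (auto simp: d)
  have e: "p + 2 * q = (p + q) + q" by simp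
  have t: "U b (p + 2 * q) = U b (p + q) * (u' - b * u) + U b (Suc (p + q)) * u"
    "U b (Suc (p + 2 * q)) = U b (Suc (p + q)) * u' + U b (p + q) * u"
    unfolding e using U_add[of b "p + q" q] by (auto simp: d)
  have c: "(-1) ^ q = u' ^ 2 - b * u' * u - u ^ 2"
    using U_cassini[of b q] by (simp add: d)
  note f = V_eq s t c d[symmetric]
  show "U b (p + 2 * q) = U b q * V b (p + q) + (-1) ^ q * U b p"
    unfolding f by (simp add: power2_eq_square algebra_simps)
  show "U b (p + 2 * q) = V b q * U b (p + q) - (-1) ^ q * U b p"
    unfolding f by (simp add: power2_eq_square algebra_simps)
  show "V b (p + 2 * q) = (b\<^sup>2 + 4) * U b q * U b (p + q) + (-1) ^ q * V b p"
    unfolding f by (simp add: power2_eq_square algebra_simps)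
qed

lemma V_Suc: "V b (Suc n) = U b (Suc (Suc n)) + U b n"
  by (simp add: V_eq)

section \<open>Positivity and growth of U and V\<close>

lemma U_nonneg: "b \<ge> 1 \<Longrightarrow> U b n \<ge> 0"
  by (induction b "0::int" "1::int" n rule: luc.induct) auto

lemma U_le_Suc:
  assumes "b \<ge> 1" shows "U b n \<le> U b (Suc n)"
proof (cases n)
  case (Suc k)
  have "1 * U b (Suc k) \<le> b * U b (Suc k)"
    using assms U_nonneg[OF assms] by (intro mult_right_mono) auto
  then show ?thesis using Suc U_nonneg[OF assms, of k] by simp
qed simp

lemma U_mono: "b \<ge> 1 \<Longrightarrow> i \<le> j \<Longrightarrow> U b i \<le> U b j"
  using U_le_Suc[of b] by (rule lift_Suc_mono_le) auto

lemma U_pos: "b \<ge> 1 \<Longrightarrow> n \<ge> 1 \<Longrightarrow> U b n > 0"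
  using U_mono[of b 1 n] by simp

text \<open>For b = 1 the values U_1 and U_2 coincide; the last hypothesis excludes this
  tie.\<close>

lemma U_less:
  assumes "b \<ge> 1" "i < j" "b \<ge> 2 \<or> j \<ge> 3"
  shows "U b i < U b j"
proof -
  obtain k where k: "j = Suc k" using assms by (cases j) auto
  have "U b k < U b (Suc k)"
  proof (cases k)
    case (Suc l)
    show ?thesis
    proof (cases "b \<ge> 2")
      case True
      have "2 * U b (Suc l) \<le> b * U b (Suc l)"
        using True U_nonneg[of b "Suc l"] by (intro mult_right_mono) auto
      moreover have "U b (Suc k) = b * U b (Suc l) + U b l" using Suc by simp
      moreover have "U b (Suc l) > 0" "U b l \<ge> 0" using U_pos U_nonneg assms(1) by auto
      ultimately show ?thesis unfolding Suc by linarith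
    next
      case False
      then have "l \<ge> 1" "b = 1" using assms Suc k by auto
      then show ?thesis using Suc U_pos[of b l] by simp
    qed
  qed simp
  moreover have "U b i \<le> U b k" using assms k by (intro U_mono) auto
  ultimately show ?thesis using k by simp
qed

lemma V_pos:
  assumes "b \<ge> 1" shows "V b n > 0"
proof (cases n)
  case (Suc k)
  then show ?thesis using V_Suc[of b k] U_pos[OF assms, of "Suc (Suc k)"] U_nonneg[OF assms, of k]
    by (simp del: luc.simps)
qed simp

section \<open>Counting residues\<close>

lemma cong_small_eq:
  fixes u v M :: int
  assumes "[u = v] (mod M)" "2 * \<bar>u\<bar> < M" "2 * \<bar>v\<bar> < M"
  shows "u = v"
proof -
  have "M dvd (u - v)" using assms(1) by (simp add: cong_iff_dvd_diff)
  moreover have "\<bar>u - v\<bar> < M" using assms by linarith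
  ultimately show ?thesis using dvd_imp_le_int[of "u - v" M] by fastforce
qed

text \<open>The hypothesis \<open>hit\<close> finds each v only up to sign, and \<open>neg\<close>
  supplies the other sign. So the residues are those of A and -A, which are distinct and nonzero
  because these numbers are nonzero and less than M / 2 in absolute value.\<close>

lemma rho_symmetric:
  assumes fin: "finite A" and A: "\<And>v. v \<in> A \<Longrightarrow> 0 < v \<and> 2 * v < M"
    and sub: "\<And>j. \<exists>v\<in>A. [x j = v] (mod M) \<or> [x j = - v] (mod M)"
    and hit: "\<And>v. v \<in> A \<Longrightarrow> \<exists>j. [x j = v] (mod M) \<or> [x j = - v] (mod M)"
    and neg: "\<And>j. \<exists>i. [x i = - x j] (mod M)"
  shows "rho x M = 2 * card A \<and> (\<forall>j. \<not> M dvd x j)"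
proof -
  let ?B = "A \<union> uminus ` A"
  have B: "2 * \<bar>u\<bar> < M \<and> u \<noteq> 0" if "u \<in> ?B" for u using that A by force
  have hitB: "\<exists>j. [x j = u] (mod M)" if u: "u \<in> ?B" for u
  proof -
    obtain v where v: "v \<in> A" "u = v \<or> u = - v" using u by (elim UnE imageE) auto
    obtain j where j: "[x j = v] (mod M) \<or> [x j = - v] (mod M)" using hit v by blast
    obtain i where i: "[x i = - x j] (mod M)" using neg by blast
    from j show ?thesis
    proof
      assume a: "[x j = v] (mod M)"
      then have "[- x j = - v] (mod M)" by (simp add: cong_minus_minus_iff)
      with i have "[x i = - v] (mod M)" by (rule cong_trans)
      then show ?thesis using a v(2) by blast
    next
      assume a: "[x j = - v] (mod M)"
      then have "[- x j = - (- v)] (mod M)" by (simp only: cong_minus_minus_iff)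
      with i have "[x i = - (- v)] (mod M)" by (rule cong_trans)
      then show ?thesis using a v(2) by auto
    qed
  qed
  have "(\<lambda>n. x n mod M) ` UNIV = (\<lambda>u. u mod M) ` ?B"
  proof (intro equalityI subsetI)
    fix r assume "r \<in> (\<lambda>n. x n mod M) ` UNIV"
    then obtain j where j: "r = x j mod M" by blast
    obtain v where "v \<in> A" "[x j = v] (mod M) \<or> [x j = - v] (mod M)" using sub by blast
    then show "r \<in> (\<lambda>u. u mod M) ` ?B" unfolding j cong_def by blast
  next
    fix r assume "r \<in> (\<lambda>u. u mod M) ` ?B"
    then obtain u where u: "u \<in> ?B" "r = u mod M" by (elim imageE)
    obtain j where "x j mod M = u mod M" using hitB[OF u(1)] unfolding cong_def by (elim exE)
    then show "r \<in> (\<lambda>n. x n mod M) ` UNIV" using u(2) by (metis rangeI)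
  qed
  moreover have "inj_on (\<lambda>u. u mod M) ?B"
    using B cong_small_eq unfolding inj_on_def cong_def by blast
  moreover have "card ?B = 2 * card A"
  proof -
    have "- v \<notin> A" if "v \<in> A" for v using A[of v] A[of "- v"] that by auto
    then have "A \<inter> uminus ` A = {}" by auto
    then have "card ?B = card A + card (uminus ` A)" using fin by (simp add: card_Un_disjoint)
    then show ?thesis by (simp add: card_image)
  qed
  ultimately have "rho x M = 2 * card A" unfolding rho_def by (simp add: card_image)
  moreover have "\<not> M dvd x j" for j
  proof
    assume "M dvd x j"
    then have "[x j = 0] (mod M)" by (simp add: cong_0_iff)
    moreover obtain v where v: "v \<in> A" "[x j = v] (mod M) \<or> [x j = - v] (mod M)"
      using sub by blast
    ultimately have "[v = 0] (mod M) \<or> [- v = 0] (mod M)" by (metis cong_sym cong_trans)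
    then show False using B[of v] B[of "- v"] v(1) cong_small_eq[of v 0 M]
      cong_small_eq[of "- v" 0 M] A[OF v(1)] by auto
  qed
  ultimately show ?thesis by blast
qed

lemma range_mod_periodic:
  fixes x :: "nat \<Rightarrow> int"
  assumes k: "k > 0" and per: "\<And>j. [x (j + k) = x j] (mod m)"
  shows "range (\<lambda>n. x n mod m) = (\<lambda>n. x n mod m) ` {..<k}"
proof -
  have red: "x j mod m = x (j mod k) mod m" for j
  proof (induction j rule: less_induct)
    case (less j)
    show ?case
    proof (cases "j < k")
      case False
      then have "x j mod m = x (j - k) mod m"
        using per[of "j - k"] by (simp add: cong_def)
      then show ?thesis using less[of "j - k"] False k by (simp add: le_mod_geq)
    qed simp
  qed
  show ?thesis
  proof (intro equalityI subsetI)
    fix r assume "r \<in> range (\<lambda>n. x n mod m)"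
    then obtain j where "r = x j mod m" by blast
    then have "r = x (j mod k) mod m" "j mod k \<in> {..<k}" using red k by auto
    then show "r \<in> (\<lambda>n. x n mod m) ` {..<k}" by blast
  qed auto
qed

text \<open>Each v_j occurs with one sign only. Distinct absolute values below M / 2 already force
  distinct residues, so one period contributes exactly k of them.\<close>

lemma rho_periodic:
  assumes k: "k > 0" and per: "\<And>j. [x (j + k) = x j] (mod M)"
    and v: "\<And>j. j < k \<Longrightarrow> 0 < v j \<and> 2 * v j < M" and inj: "inj_on v {..<k}"
    and x: "\<And>j. j < k \<Longrightarrow> [x j = v j] (mod M) \<or> [x j = - v j] (mod M)"
  shows "rho x M = k \<and> (\<forall>j. \<not> M dvd x j)"
proof -
  have range: "range (\<lambda>n. x n mod M) = (\<lambda>n. x n mod M) ` {..<k}"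
    using k per by (rule range_mod_periodic)
  obtain y where y: "\<And>j. j < k \<Longrightarrow> [x j = y j] (mod M) \<and> (y j = v j \<or> y j = - v j)"
  proof
    fix j assume "j < k"
    then show "[x j = (if [x j = v j] (mod M) then v j else - v j)] (mod M)
       \<and> ((if [x j = v j] (mod M) then v j else - v j) = v j
       \<or> (if [x j = v j] (mod M) then v j else - v j) = - v j)" using x by auto
  qed
  have yb: "2 * \<bar>y j\<bar> < M \<and> y j \<noteq> 0" if "j < k" for j using y[OF that] v[OF that] by auto
  have "inj_on (\<lambda>n. x n mod M) {..<k}"
  proof (rule inj_onI)
    fix i j assume ij: "i \<in> {..<k}" "j \<in> {..<k}" "x i mod M = x j mod M"
    then have "[y i = y j] (mod M)" using y unfolding cong_def by (metis lessThan_iff)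
    then have "y i = y j" using cong_small_eq yb ij by blast
    then have "v i = v j" using y[of i] y[of j] v[of i] v[of j] ij by auto
    then show "i = j" using inj ij by (auto dest: inj_onD)
  qed
  then have "rho x M = k" unfolding rho_def range by (simp add: card_image)
  moreover have "\<not> M dvd x j" for j
  proof
    assume "M dvd x j"
    then have "0 \<in> range (\<lambda>n. x n mod M)" by (metis dvd_imp_mod_0 rangeI)
    then obtain i where i: "i < k" "x i mod M = 0" unfolding range by auto
    then have "[y i = 0] (mod M)" using y[of i] by (simp add: cong_def)
    moreover have "2 * \<bar>0::int\<bar> < M" using yb[OF i(1)] by linarith
    ultimately show False using cong_small_eq[of "y i" 0 M] yb[OF i(1)] by blast
  qed
  ultimately show ?thesis by blast
qed

lemma pm_power: "s = 1 \<or> s = (-1::int) \<Longrightarrow> s ^ j = 1 \<or> s ^ j = -1"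
  by (cases "even j") auto

lemma cong_pm_sign:
  fixes x v M t :: int
  assumes "t = 1 \<or> t = -1" "[x = v] (mod M) \<or> [x = - v] (mod M)"
  shows "[t * x = v] (mod M) \<or> [t * x = - v] (mod M)"
proof (cases "t = 1")
  case False
  then have "t * x = - x" using assms(1) by simp
  moreover have "[- x = - v] (mod M) \<or> [- x = - (- v)] (mod M)"
    using assms(2) by (simp only: cong_minus_minus_iff)
  ultimately show ?thesis by auto
qed (use assms in simp)

lemma cong_pm_trans:
  fixes x y v M :: int
  assumes "[x = y] (mod M) \<or> [x = - y] (mod M)" "[y = v] (mod M) \<or> [y = - v] (mod M)"
  shows "[x = v] (mod M) \<or> [x = - v] (mod M)"
  using assms(1)
proof
  assume "[x = y] (mod M)"
  then show ?thesis using assms(2) by (blast intro: cong_trans)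
next
  assume "[x = - y] (mod M)"
  moreover have "[- y = v] (mod M) \<or> [- y = - v] (mod M)"
    using cong_pm_sign[of "-1" y v M] assms(2) by simp
  ultimately show ?thesis by (blast intro: cong_trans)
qed

text \<open>The hypothesis \<open>refl\<close> folds indices between h and 2 h back below h, and
  \<open>anti\<close> lowers the larger ones by 2 h, so v_0, ..., v_h represent all terms up to
  sign. The antiperiod also makes the residues closed under negation.\<close>

lemma reflected_family:
  assumes s: "s = 1 \<or> s = -1" and h: "h > 0"
    and inj: "inj_on v {..h}" and v: "\<And>j. j \<le> h \<Longrightarrow> 0 < v j \<and> 2 * v j < M"
    and w: "\<And>j. j \<le> h \<Longrightarrow> [w j = v j] (mod M) \<or> [w j = - v j] (mod M)"
    and anti: "\<And>j. [w (j + 2 * h) = - w j] (mod M)"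
    and refl: "\<And>j. j \<le> h \<Longrightarrow> [w (h + j) = w (h - j)] (mod M) \<or> [w (h + j) = - w (h - j)] (mod M)"
  shows "rho (\<lambda>j. s ^ j * w j) M = 2 * (h + 1) \<and> (\<forall>j. \<not> M dvd s ^ j * w j)"
proof -
  have sub: "\<exists>u\<in>v ` {..h}. [w j = u] (mod M) \<or> [w j = - u] (mod M)" for j
  proof (induction j rule: less_induct)
    case (less j)
    consider "j \<le> h" | "h < j" "j < 2 * h" | "2 * h \<le> j" by linarith
    then show ?case
    proof cases
      case 1
      then show ?thesis using w by blast
    next
      case 2
      then have lt: "2 * h - j < j" by linarith
      have "[w j = w (2 * h - j)] (mod M) \<or> [w j = - w (2 * h - j)] (mod M)"
        using refl[of "j - h"] 2 by (simp add: mult_2)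
      moreover obtain u where "u \<in> v ` {..h}"
        "[w (2 * h - j) = u] (mod M) \<or> [w (2 * h - j) = - u] (mod M)"
        using less[OF lt] by blast
      ultimately show ?thesis using cong_pm_trans by blast
    next
      case 3
      then have lt: "j - 2 * h < j" using h by linarith
      have "[w j = - w (j - 2 * h)] (mod M)" using anti[of "j - 2 * h"] 3 by simp
      moreover obtain u where "u \<in> v ` {..h}"
        "[w (j - 2 * h) = u] (mod M) \<or> [w (j - 2 * h) = - u] (mod M)"
        using less[OF lt] by blast
      ultimately show ?thesis using cong_pm_trans by blast
    qed
  qed
  have "rho (\<lambda>j. s ^ j * w j) M = 2 * card (v ` {..h}) \<and> (\<forall>j. \<not> M dvd s ^ j * w j)"
  proof (rule rho_symmetric)
    show "\<exists>u\<in>v ` {..h}. [s ^ j * w j = u] (mod M) \<or> [s ^ j * w j = - u] (mod M)" for j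
      using sub[of j] cong_pm_sign[OF pm_power[OF s]] by blast
    show "\<exists>j. [s ^ j * w j = u] (mod M) \<or> [s ^ j * w j = - u] (mod M)" if "u \<in> v ` {..h}" for u
      using that w cong_pm_sign[OF pm_power[OF s]] by blast
    show "\<exists>i. [s ^ i * w i = - (s ^ j * w j)] (mod M)" for j
    proof
      \<comment> \<open>The shift 2 h is even, so the twist by s^j preserves the antiperiod.\<close>
      have "s ^ (j + 2 * h) = s ^ j" using s by (auto simp: power_add power_mult)
      then show "[s ^ (j + 2 * h) * w (j + 2 * h) = - (s ^ j * w j)] (mod M)"
        using cong_scalar_left[OF anti[of j], of "s ^ j"] by simp
    qed
  qed (use v in auto)
  then show ?thesis using inj by (simp add: card_image)
qed

section \<open>Sequences of odd period modulo a companion Lucas number\<close>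

text \<open>Among pairs with a fixed index sum, both signed values of one pair lie below both of the
  next. For b = 1 this fails at p = q + 1 and p = q + 2.\<close>

lemma pair_gap:
  assumes "b \<ge> 1" "1 \<le> q" "q < p" "b \<ge> 2 \<or> p \<ge> q + 3"
  shows "U b p + U b q < U b (Suc p) - U b (q - 1)"
proof -
  obtain r where r: "p = Suc r" using assms by (cases p) auto
  obtain l where l: "q = Suc l" using assms by (cases q) auto
  have e: "U b (Suc p) = b * U b p + U b r" using r by simp
  show ?thesis
  proof (cases "b \<ge> 2")
    case True
    have "2 * U b p \<le> b * U b p"
      using True U_nonneg[of b p] by (intro mult_right_mono) auto
    moreover have "U b q \<le> U b r" using assms r by (intro U_mono) auto
    moreover have "U b l < U b p" using assms l True by (intro U_less) auto
    ultimately show ?thesis using e l by simp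
  next
    case False
    then have b: "b = 1" "p \<ge> q + 3" using assms by auto
    \<comment> \<open>Since U_q + U_(q-1) = U_(q+1) and U_(p+1) = U_p + U_(p-1), the claim reduces
      to U_(q+1) < U_(p-1).\<close>
    have "U b (Suc q) < U b r" using b r assms by (intro U_less) auto
    then show ?thesis using e l b by simp
  qed
qed

lemma abs_pair_neq:
  assumes b: "b \<ge> 1" and odd: "odd (p + q)" and big: "b \<ge> 2 \<or> p + q \<ge> 5"
    and pq: "q < p" "p < p'" "p + q = p' + q'"
    and st: "s = 1 \<or> s = -1" "t = 1 \<or> t = -1"
  shows "\<bar>U b p + s * U b q\<bar> \<noteq> \<bar>U b p' + t * U b q'\<bar>"
proof -
  have q1: "1 \<le> q" using pq by linarith
  have nn: "U b n \<ge> 0" for n using U_nonneg b by blast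
  have ord: "U b q \<le> U b p" "U b q' \<le> U b p'" using b pq by (auto intro!: U_mono)
  have S: "s * U b q = U b q \<or> s * U b q = - U b q" and T: "t * U b q' = U b q' \<or> t * U b q' = - U b q'"
    using st by auto
  have abs: "\<bar>U b p + s * U b q\<bar> = U b p + s * U b q" "\<bar>U b p' + t * U b q'\<bar> = U b p' + t * U b q'"
    using S T ord nn[of p] nn[of q] nn[of p'] nn[of q'] by linarith+
  show ?thesis
  proof (cases "b \<ge> 2 \<or> p \<ge> q + 3")
    case True
    have "U b p + U b q < U b (Suc p) - U b (q - 1)" using pair_gap b q1 pq True by blast
    moreover have "U b (Suc p) \<le> U b p'" "U b q' \<le> U b (q - 1)"
      using b pq by (auto intro!: U_mono)
    ultimately show ?thesis unfolding abs using S T nn[of q] nn[of q'] by linarith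
  next
    case False
    then have b1: "b = 1" using b by simp
    have "p = q + 1 \<or> p = q + 2" using False pq by linarith
    \<comment> \<open>As p + q is odd, only the middle pair escapes the gap estimate.\<close>
    then have "p = q + 1" using odd by auto
    moreover obtain r where r: "q = Suc r" using q1 by (cases q) auto
    ultimately have p: "p = Suc (Suc r)" by simp
    have "r \<ge> 1" using big b1 p r by simp
    then have x: "U b r > 0" using U_pos b by blast
    have y: "U b r \<le> U b (Suc r)" using U_le_Suc b by blast
    \<comment> \<open>The middle pair gives U_r and 2 U_(r+1) + U_r; the next pair gives 2 U_(r+1)
      and 2 U_(r+1) + 2 U_r. These interlace, but stay distinct because 0 < U_r \<le>
      U_(r+1).\<close>
    have eqs: "U b q = U b (Suc r)" "U b p = U b (Suc r) + U b r" "U b (Suc p) = 2 * U b (Suc r) + U b r"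
      "U b (Suc (Suc p)) = 3 * U b (Suc r) + 2 * U b r"
      using p r b1 by simp_all
    show ?thesis
    proof (cases "p' = Suc p")
      case True
      then have "U b p' = U b (Suc p)" "U b q' = U b r" using pq p r by simp_all
      then show ?thesis unfolding abs using S T eqs x y by linarith
    next
      case False
      then have "Suc (Suc p) \<le> p'" "q' \<le> r" using pq r by simp_all
      then have "U b (Suc (Suc p)) \<le> U b p'" "U b q' \<le> U b r" using b by (blast intro: U_mono)+
      then show ?thesis unfolding abs using S T eqs x y nn[of q'] by linarith
    qed
  qed
qed

text \<open>With h = p + q, this combines U_p + U_q \<le> U_h with 2 U_h < V_h. For b = 1 and h = 3
  the latter becomes an equality, hence the demand 5 \<le> p + q.\<close>

lemma abs_pair_bounds:
  assumes b: "b \<ge> 1" and h: "3 \<le> p + q" "b \<ge> 2 \<or> 5 \<le> p + q"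
    and pq: "q < p" and odd: "odd (p + q)" and s: "s = 1 \<or> s = -1"
  shows "0 < \<bar>U b p + s * U b q\<bar> \<and> 2 * \<bar>U b p + s * U b q\<bar> < V b (p + q)"
proof -
  have nn: "U b n \<ge> 0" for n using U_nonneg b by blast
  obtain g where g: "p + q = Suc g" using h by (cases "p + q") auto
  obtain r where r: "g = Suc r" using h g by (cases g) auto
  have less: "U b q < U b p" using b h pq by (intro U_less) auto
  have "U b p + U b q \<le> U b (p + q)"
  proof (cases "q = 0")
    case False
    obtain l where l: "p = Suc l" using pq by (cases p) auto
    have "1 * U b p \<le> b * U b p" using b nn[of p] by (intro mult_right_mono) auto
    moreover have "U b q \<le> U b l" using b pq l by (intro U_mono) auto
    ultimately have "U b p + U b q \<le> U b (Suc p)" using l by simp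
    also have "\<dots> \<le> U b (p + q)" using b False by (intro U_mono) auto
    finally show ?thesis .
  qed simp
  moreover have "2 * U b (p + q) < V b (p + q)"
  proof -
    have e: "V b (p + q) = b * U b (p + q) + 2 * U b g" using V_Suc[of b g] g by simp
    show ?thesis
    proof (cases "b \<ge> 2")
      case True
      have "2 * U b (p + q) \<le> b * U b (p + q)"
        using True nn[of "p + q"] by (intro mult_right_mono) auto
      then show ?thesis using e U_pos[of b g] b r by simp
    next
      case False
      have "U b r < U b g" using False b h g r by (intro U_less) auto
      moreover have "b = 1" using False b by simp
      moreover have "U b (p + q) = b * U b g + U b r" using g r by simp
      ultimately show ?thesis using e by simp
    qed
  qed
  moreover have "s * U b q = U b q \<or> s * U b q = - U b q" using s by auto
  ultimately have "0 < U b p + s * U b q" "2 * (U b p + s * U b q) < V b (p + q)"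
    using less nn[of p] nn[of q] by (elim disjE; simp)+
  then show ?thesis by simp
qed

text \<open>Up to sign, this is the residue of U_(j+h) + e U_j modulo V_h: reflection about h turns
  U_(j+h) into (-1)^j U_(h-j), and a common factor e = 1 or -1 disappears in the absolute
  value.\<close>

definition pairval :: "int \<Rightarrow> nat \<Rightarrow> int \<Rightarrow> nat \<Rightarrow> int" where
  "pairval b h e j = \<bar>U b j + e * (-1) ^ j * U b (h - j)\<bar>"

lemma pairval_max_min:
  assumes "odd h" "j < h" "e = 1 \<or> e = -1"
  obtains p q s where "p + q = h" "q < p" "s = 1 \<or> s = -1" "pairval b h e j = \<bar>U b p + s * U b q\<bar>"
    "p = max j (h - j)"
proof -
  define s where "s = e * (-1) ^ j"
  have s: "s = 1 \<or> s = -1" using assms(3) unfolding s_def by (cases "even j") auto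
  show ?thesis
  proof (cases "j > h - j")
    case True
    then show ?thesis using assms s that[of j "h - j" s] by (simp add: pairval_def s_def)
  next
    case False
    moreover have "j \<noteq> h - j" using assms(1,2) by presburger
    moreover have "\<bar>U b j + s * U b (h - j)\<bar> = \<bar>U b (h - j) + s * U b j\<bar>" using s by auto
    ultimately show ?thesis using assms s that[of "h - j" j s] by (simp add: pairval_def s_def)
  qed
qed

lemma pairval_bounds:
  assumes "b \<ge> 1" "odd h" "3 \<le> h" "b \<ge> 2 \<or> 5 \<le> h" "e = 1 \<or> e = -1" "j < h"
  shows "0 < pairval b h e j \<and> 2 * pairval b h e j < V b h"
proof -
  obtain p q s where P: "p + q = h" "q < p" "s = 1 \<or> s = -1" "pairval b h e j = \<bar>U b p + s * U b q\<bar>"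
    using pairval_max_min[OF assms(2,6,5)] by metis
  show ?thesis using abs_pair_bounds[OF assms(1) _ _ P(2) _ P(3)] assms(2-4) P(1,4) by simp
qed

text \<open>Different unordered pairs {j, h - j} are separated by \<open>abs_pair_neq\<close>.
  Within one pair the indices have opposite parity, so the two values are the sum and, up to sign,
  the difference of the same two positive numbers.\<close>

lemma pairval_inj:
  assumes b: "b \<ge> 1" and h: "odd h" "3 \<le> h" "b \<ge> 2 \<or> 5 \<le> h" and e: "e = 1 \<or> e = -1"
  shows "inj_on (pairval b h e) {..<h}"
proof (rule inj_onI)
  fix i j assume "i \<in> {..<h}" "j \<in> {..<h}" and eq: "pairval b h e i = pairval b h e j"
  then have ij: "i < h" "j < h" by auto
  obtain p q s where P: "p + q = h" "q < p" "s = 1 \<or> s = -1" "pairval b h e i = \<bar>U b p + s * U b q\<bar>"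
    "p = max i (h - i)" using pairval_max_min[OF h(1) ij(1) e] by metis
  obtain p' q' t where P': "p' + q' = h" "q' < p'" "t = 1 \<or> t = -1"
    "pairval b h e j = \<bar>U b p' + t * U b q'\<bar>" "p' = max j (h - j)"
    using pairval_max_min[OF h(1) ij(2) e] by metis
  have "\<not> p < p'"
    using abs_pair_neq[OF b _ _ P(2) _ _ P(3) P'(3), of p' q'] h P(1,4) P'(1,4) eq by auto
  moreover have "\<not> p' < p"
    using abs_pair_neq[OF b _ _ P'(2) _ _ P'(3) P(3), of p q] h P'(1,4) P(1,4) eq by auto
  ultimately have "max i (h - i) = max j (h - j)" using P(5) P'(5) by linarith
  then have "i = j \<or> i = h - j" using ij by linarith
  moreover have False if i: "i = h - j"
  proof -
    have jp: "1 \<le> j" using i ij by linarith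
    define c :: int where "c = e * (-1) ^ j"
    have c: "c = 1 \<or> c = -1" using e unfolding c_def by (cases "even j") auto
    have "even i \<longleftrightarrow> odd j" using i ij h(1) by presburger
    then have "e * (-1) ^ i = - c" unfolding c_def by (cases "even j") auto
    then have "\<bar>U b (h - j) - c * U b j\<bar> = \<bar>U b j + c * U b (h - j)\<bar>"
      using eq ij i unfolding pairval_def c_def by simp
    moreover have "U b j > 0" "U b (h - j) > 0" using U_pos[OF b] jp ij by auto
    moreover have "c * U b j = U b j \<or> c * U b j = - U b j"
      "c * U b (h - j) = U b (h - j) \<or> c * U b (h - j) = - U b (h - j)" 
      "c * U b j = U b j \<longleftrightarrow> c * U b (h - j) = U b (h - j)" using c calculation by auto
    ultimately show False by linarith
  qed
  ultimately show "i = j" by blast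
qed

text \<open>The twist multiplies the shift factor e by s^h = s, so e = s makes h a period and e = -s
  makes it an antiperiod.\<close>

lemma odd_period_family:
  assumes s: "s = 1 \<or> s = -1" and e: "e = 1 \<or> e = -1"
    and b: "b \<ge> 1" and h: "odd h" "3 \<le> h" "b \<ge> 2 \<or> 5 \<le> h"
  obtains x where "binrec (s * b) x" "\<And>j. [x (j + h) = s * e * x j] (mod V b h)"
    "\<And>j. j < h \<Longrightarrow> [x j = pairval b h e j] (mod V b h) \<or> [x j = - pairval b h e j] (mod V b h)"
proof
  define x where "x = (\<lambda>j. s ^ j * (U b (j + h) + e * U b j))"
  have ss: "s * s = 1" using s by auto
  have "binrec b (\<lambda>j. U b (j + h) + e * U b j)" by (simp add: binrec_def algebra_simps)
  then show "binrec (s * b) x" unfolding x_def using ss by (rule binrec_twist)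
  have sh: "s ^ h = s" using s h(1) by auto
  have ee: "e * e = 1" using e by auto
  show "[x (j + h) = s * e * x j] (mod V b h)" for j
  proof -
    \<comment> \<open>For odd h the sign in the reflection formula makes U_(j+2h) congruent to U_j
      modulo V_h.\<close>
    have "U b (j + h + h) = V b h * U b (j + h) + U b j"
      using U_add_double'[of b j h] h(1) by (simp add: mult_2 add.assoc)
    then have "x (j + h) - s * e * x j = s * s ^ j * (V b h * U b (j + h) + U b j * (1 - e * e))"
      unfolding x_def power_add sh by (simp add: algebra_simps)
    then show ?thesis using ee by (simp add: cong_iff_dvd_diff)
  qed
  show "[x j = pairval b h e j] (mod V b h) \<or> [x j = - pairval b h e j] (mod V b h)" if j: "j < h" for j
  proof -
    define w where "w = U b j + e * (-1) ^ j * U b (h - j)"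
    have "U b (j + h) = U b j * V b h + (-1) ^ j * U b (h - j)"
      using U_add_double[of b "h - j" j] j by (simp add: add.commute)
    then have "x j - s ^ j * e * w = s ^ j * (U b j * V b h + (-1) ^ j * U b (h - j) * (1 - e * e))"
      unfolding x_def w_def by (simp add: algebra_simps)
    then have "[x j = s ^ j * e * w] (mod V b h)" using ee by (simp add: cong_iff_dvd_diff)
    moreover have "s ^ j * e = 1 \<or> s ^ j * e = -1" using s e by (cases "even j") auto
    moreover have "pairval b h e j = w \<or> pairval b h e j = - w" unfolding pairval_def w_def by linarith
    ultimately show ?thesis by auto
  qed
qed

section \<open>The Lucas and Pell families\<close>

definition avoids :: "int \<Rightarrow> nat \<Rightarrow> bool" where
  "avoids a n \<longleftrightarrow> (\<exists>x m. binrec a x \<and> m \<ge> 1 \<and> rho x m = n \<and> (\<forall>j. \<not> m dvd x j))"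

lemma avoids_lucas:
  assumes s: "s = 1 \<or> s = -1" and b: "b \<ge> 1" "b \<noteq> 2" and h: "odd h"
  shows "avoids (s * b) (2 * (h + 1))"
proof -
  let ?M = "(b\<^sup>2 + 4) * U b h"
  have Vs: "V b (Suc n) < V b (Suc (Suc n))" for n
  proof -
    have "1 * V b (Suc n) \<le> b * V b (Suc n)"
      using b V_pos[of b "Suc n"] by (intro mult_right_mono) auto
    then show ?thesis using V_pos[of b n] b by simp
  qed
  have Vless: "V b i < V b j" if ij: "1 \<le> i" "i < j" for i j
  proof -
    obtain i' j' where "i = Suc i'" "j = Suc j'" using ij by (metis Suc_le_D Suc_lessE One_nat_def)
    then show ?thesis using lift_Suc_mono_less[of "\<lambda>n. V b (Suc n)" i' j', OF Vs] ij by simp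
  qed
  \<comment> \<open>The increasing chain starts at V_1, since V_0 = 2 exceeds V_1 = 1 when b = 1;
    V_0 is compared with the later terms separately.\<close>
  have V0: "V b 0 < V b j" if "2 \<le> j" for j
  proof -
    have "V b 2 = b * b + 2" by (simp add: numeral_2_eq_2)
    moreover have "b * b > 0" using b by simp
    moreover have "V b 2 \<le> V b j" using Vless[of 2 j] that by (cases "j = 2") auto
    ultimately show ?thesis by simp
  qed
  have neq: "V b i \<noteq> V b j" if "i < j" for i j
  proof (cases "1 \<le> i")
    case True then show ?thesis using Vless[of i j] that by simp
  next
    case False
    then have i: "i = 0" by simp
    show ?thesis
    proof (cases "2 \<le> j")
      case True then show ?thesis using V0 i by fastforce
    next
      case False then have "j = Suc 0" using that i by simp
      then show ?thesis using i b by simp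
    qed
  qed
  have inj: "inj_on (V b) {..h}" by (rule inj_onI) (metis neq nat_neq_iff)
  obtain g where g: "h = Suc g" using h by (cases h) auto
  have Uh: "U b h \<ge> 1" using U_pos[of b h] b g by simp
  have top: "2 * V b h < ?M"
  proof -
    have e: "V b h = b * U b h + 2 * U b g" using V_Suc[of b g] g by simp
    show ?thesis
    proof (cases "b = 1")
      case True
      \<comment> \<open>For b = 1, V_h = U_h + 2 U_(h-1), so the claim 2 V_h < 5 U_h amounts to
        this.\<close>
      have "4 * U b g < 3 * U b h"
      proof (cases g)
        case (Suc r)
        \<comment> \<open>Oddness of h rules out r = 0, that is h = 2, where the inequality
          fails.\<close>
        then obtain t where t: "r = Suc t" using h g by (cases r) auto
        have "U b t \<le> U b r" "U b r > 0" using U_le_Suc[of b t] U_pos[of b r] b t by auto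
        then show ?thesis using True g Suc t by simp
      qed (use g in simp)
      then show ?thesis using e True by simp
    next
      case False
      then have "b \<ge> 3" using b by simp
      then have "b * b \<ge> 3 * b" by (intro mult_right_mono) auto
      \<comment> \<open>Subtracting 2 b U_h leaves (b^2 + 4 - 2 b) U_h to exceed 4 U_(h-1), and 7
        suffices as U_(h-1) \<le> U_h.\<close>
      then have "b\<^sup>2 + 4 - 2 * b \<ge> 7" using \<open>b \<ge> 3\<close> unfolding power2_eq_square by linarith
      then have "7 * U b h \<le> (b\<^sup>2 + 4 - 2 * b) * U b h" using Uh by (intro mult_right_mono) auto
      moreover have "U b g \<le> U b h" using U_le_Suc b g by simp
      ultimately show ?thesis using e Uh by (simp add: algebra_simps)
    qed
  qed
  \<comment> \<open>This is the bound for V_0 = 2, which \<open>top\<close> does not cover: V_0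
    exceeds V_h when b = h = 1.\<close>
  have "4 < ?M"
  proof -
    have "4 < b\<^sup>2 + 4" using b by simp
    also have "(b\<^sup>2 + 4) * 1 \<le> ?M" using Uh by (intro mult_left_mono) auto
    then have "b\<^sup>2 + 4 \<le> ?M" by (simp only: mult_1_right)
    finally show ?thesis .
  qed
  have bnd: "0 < V b j \<and> 2 * V b j < ?M" if "j \<le> h" for j
  proof (cases "j = 0")
    case False
    then have "V b j \<le> V b h" using Vless[of j h] that by (cases "j = h") auto
    then show ?thesis using top V_pos b by simp
  qed (use \<open>4 < ?M\<close> in simp)
  have "rho (\<lambda>j. s ^ j * V b j) ?M = 2 * (h + 1) \<and> (\<forall>j. \<not> ?M dvd s ^ j * V b j)"
  proof (rule reflected_family[OF s _ inj])
    show "[V b (j + 2 * h) = - V b j] (mod ?M)" for j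
      using V_add_double[of b j h] h by (simp add: cong_iff_dvd_diff)
    show "[V b (h + j) = V b (h - j)] (mod ?M) \<or> [V b (h + j) = - V b (h - j)] (mod ?M)"
      if j: "j \<le> h" for j
    proof -
      have "V b (h + j) = ?M * U b j + (-1) ^ j * V b (h - j)"
        using V_add_double[of b "h - j" j] j by (simp add: ac_simps)
      then show ?thesis by (cases "even j") (auto simp: cong_iff_dvd_diff)
    qed
  qed (use bnd h in \<open>auto simp: odd_pos\<close>)
  moreover have "binrec (s * b) (\<lambda>j. s ^ j * V b j)"
    using binrec_twist binrec_luc s by force
  ultimately show ?thesis using \<open>4 < ?M\<close> unfolding avoids_def
    by (intro exI[of _ "\<lambda>j. s ^ j * V b j"] exI[of _ ?M]) auto
qed

lemma avoids_pell:
  assumes s: "s = 1 \<or> s = -1" and h: "odd h" "h \<ge> 3"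
  shows "avoids (s * 2) (2 * (h + 1))"
proof -
  define u where "u = U 2"
  have u0: "u 0 = 0" "u (Suc 0) = 1" "\<And>n. u (Suc (Suc n)) = 2 * u (Suc n) + u n"
    unfolding u_def by simp_all
  have upos: "u n > 0" if "n \<ge> 1" for n using U_pos[of 2 n] that unfolding u_def by simp
  have unn: "u n \<ge> 0" for n using U_nonneg[of 2 n] unfolding u_def by simp
  \<comment> \<open>\<open>W\<close> is half of V. Since u_j has the parity of j, the summand u_h
    u_j is 0 modulo 2 u_h for even j and u_h for odd j; \<open>v\<close> records the resulting
    absolute values. Among odd j \<le> h the absolute value matters only at j = h, where W_h >
    u_h.\<close>
  define W where "W n = u (Suc n) - u n" for n
  define w where "w n = W n + u h * u n" for n
  define v where "v j = (if even j then W j else \<bar>u h - W j\<bar>)" for j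
  let ?M = "2 * u h"
  have par: "even (u n) \<longleftrightarrow> even n" for n
    by (induction n rule: induct_nat_012) (auto simp: u0)
  have Wodd: "odd (W n)" for n unfolding W_def using par[of n] par[of "Suc n"] by auto
  have W_Suc: "W (Suc n) = u (Suc n) + u n" for n unfolding W_def u0 by simp
  have Wmono: "W i \<le> W j" if "i \<le> j" for i j
  proof (rule lift_Suc_mono_le[OF _ that])
    show "W n \<le> W (Suc n)" for n unfolding W_Suc using unn[of n] unfolding W_def by simp
  qed
  have Wless: "W i < W j" if ij: "i < j" "j \<ge> 2" for i j
  proof -
    obtain k where k: "j = Suc k" using ij by (cases j) auto
    have "W k < W (Suc k)" unfolding W_Suc using upos[of k] ij k unfolding W_def by simp
    moreover have "W i \<le> W k" using Wmono ij k by simp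
    ultimately show ?thesis using k by simp
  qed
  have Wpos: "W n > 0" for n using Wmono[of 0 n] by (simp add: W_def u0)
  obtain g where g: "h = Suc g" using h by (cases h) auto
  have gpos: "u g > 0" using upos h g by simp
  have ugh: "u g < u h" using Wpos[of g] g unfolding W_def by simp
  have Wg: "W g = u h - u g" using g by (simp add: W_def)
  have Wh: "W h = u h + u g" using g W_Suc by simp
  have vh: "v h = u g" using Wh gpos h by (simp add: v_def)
  \<comment> \<open>Next, v_h = u_g is shown to lie below every other value at an odd index: an odd
    j < h differs from the even g, so W_j < W_g = u_h - u_g.\<close>
  have small: "W j \<le> W g" "u h - W j > 0" if "j < h" for j
    using Wmono[of j g] that g Wg gpos by simp_all
  have smaller: "u h - W j > u g" if "odd j" "j < h" for j
  proof -
    have "j \<noteq> g" using that h g by auto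
    then show ?thesis using Wless[of j g] that g h Wg by simp
  qed
  have vodd: "v j = u h - W j" if "odd j" "j < h" for j
    using small(2)[OF that(2)] that(1) by (simp add: v_def)
  \<comment> \<open>As u_h and all W_j are odd, even and odd indices give values of opposite parity;
    this separates the tie W_0 = W_1.\<close>
  have vpar: "odd (v j) \<longleftrightarrow> even j" for j
    using par[of h] Wodd[of j] h unfolding v_def by auto
  have vneq: "v i \<noteq> v j" if ij: "i < j" "j \<le> h" for i j
  proof (cases "even i \<longleftrightarrow> even j")
    case False
    then show ?thesis using vpar by metis
  next
    case same: True
    then have "j \<ge> 2" using ij by (cases "i = 0") (auto elim: evenE)
    then have less: "W i < W j" using Wless ij by simp
    show ?thesis
    proof (cases "even j")
      case True
      then show ?thesis using same less by (simp add: v_def)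
    next
      case False
      then show ?thesis using same less ij vodd[of i] vodd[of j] smaller[of i] vh
        by (cases "j = h") auto
    qed
  qed
  have inj: "inj_on v {..h}" by (rule inj_onI) (metis vneq nat_neq_iff atMost_iff)
  have bnd: "0 < v j \<and> 2 * v j < ?M" if j: "j \<le> h" for j
  proof (cases "j = h")
    case True
    then show ?thesis using vh gpos ugh by simp
  next
    case False
    then have "j < h" using j by simp
    then show ?thesis using small[of j] Wpos[of j] vodd[of j] gpos Wg
      by (cases "even j") (auto simp: v_def)
  qed
  have "rho (\<lambda>j. s ^ j * w j) ?M = 2 * (h + 1) \<and> (\<forall>j. \<not> ?M dvd s ^ j * w j)"
  proof (rule reflected_family[OF s _ inj])
    show "[w j = v j] (mod ?M) \<or> [w j = - v j] (mod ?M)" for j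
    proof (cases "even j")
      case True
      then have "even (u j)" using par by simp
      then have "?M dvd u h * u j" by (metis mult.commute mult_dvd_mono dvd_refl)
      then show ?thesis using True by (simp add: cong_iff_dvd_diff w_def v_def)
    next
      case False
      then have "even (u j + 1)" using par by simp
      then have "?M dvd u h * (u j + 1)" by (metis mult.commute mult_dvd_mono dvd_refl)
      moreover have "w j - (W j - u h) = u h * (u j + 1)" unfolding w_def by (simp add: algebra_simps)
      ultimately have "[w j = W j - u h] (mod ?M)" by (simp add: cong_iff_dvd_diff)
      moreover have "v j = W j - u h \<or> v j = - (W j - u h)" using False unfolding v_def by (simp add: abs_if)
      ultimately show ?thesis by auto
    qed
    have V2: "V 2 n = 2 * W n" for n using V_eq[of 2 n] by (simp add: W_def u_def)
    have shift: "u (j + 2 * h) = ?M * W (j + h) - u j" for j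
      using U_add_double[of 2 j h] h V2 by (simp add: u_def)
    show "[w (j + 2 * h) = - w j] (mod ?M)" for j
    proof -
      have "w (j + 2 * h) - - w j = ?M * (W (Suc j + h) - W (j + h) + u h * W (j + h))"
        using shift[of "Suc j"] unfolding w_def W_def[of "j + 2 * h"] W_def[of j] shift[of j]
        by (simp add: algebra_simps)
      then show ?thesis by (simp add: cong_iff_dvd_diff)
    qed
    show "[w (h + j) = w (h - j)] (mod ?M) \<or> [w (h + j) = - w (h - j)] (mod ?M)" if j: "j \<le> h" for j
    proof -
      have "W (h + j) = ?M * (2 * u j) + (-1) ^ j * W (h - j)"
        using V_add_double[of 2 "h - j" j] j V2 by (simp add: u_def ac_simps)
      \<comment> \<open>V_h = 2 W_h makes the correction term even, so multiplying it by u_h gives a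
        multiple of the modulus.\<close>
      moreover have "u (h + j) = 2 * (u j * W h) + (-1) ^ j * u (h - j)"
        using U_add_double[of 2 "h - j" j] j V2 by (simp add: u_def ac_simps)
      ultimately have "w (h + j) - (-1) ^ j * w (h - j) = ?M * (2 * u j + u j * W h)"
        unfolding w_def by (simp add: algebra_simps)
      then have "[w (h + j) = (-1) ^ j * w (h - j)] (mod ?M)" by (simp add: cong_iff_dvd_diff)
      then show ?thesis by (cases "even j") auto
    qed
  qed (use bnd h in auto)
  moreover have "binrec 2 w" by (simp add: binrec_def w_def W_def u0 algebra_simps)
  then have "binrec (s * 2) (\<lambda>j. s ^ j * w j)" using binrec_twist s by force
  moreover have "?M \<ge> 1" using ugh gpos by simp
  ultimately show ?thesis unfolding avoids_def by blast
qed

section \<open>Small cases\<close>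

lemma rho_finite: "m \<ge> 1 \<Longrightarrow> finite (range (\<lambda>n. x n mod m))" for m :: int
  by (rule finite_subset[of _ "{0..<m}"]) auto

lemma binrec_periodic:
  assumes "binrec a x" "[x k = x 0] (mod m)" "[x (Suc k) = x (Suc 0)] (mod m)"
  shows "[x (j + k) = x j] (mod m)"
proof (induction j rule: induct_nat_012)
  case (ge2 n)
  have "[a * x (Suc n + k) + x (n + k) = a * x (Suc n) + x n] (mod m)"
    using ge2 by (intro cong_add cong_scalar_left)
  then show ?case using assms(1) by (simp add: binrec_def)
qed (use assms in auto)

text \<open>Reduces a residue set to a finite evaluation: once the initial pair recurs after k
  steps, k is a period.\<close>

lemma range_luc_mod:
  assumes "k > 0" "[luc a c d k = c] (mod m)" "[luc a c d (Suc k) = d] (mod m)"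
  shows "range (\<lambda>n. luc a c d n mod m) = (\<lambda>n. luc a c d n mod m) ` {..<k}"
  using binrec_periodic[OF binrec_luc, of a c d k m] assms by (intro range_mod_periodic) auto

lemma avoidsI:
  assumes "range (\<lambda>n. luc a c d n mod m) = R" "0 \<notin> R" "card R = n" "m \<ge> 1"
  shows "avoids a n"
proof -
  have "\<not> m dvd luc a c d j" for j
  proof
    assume "m dvd luc a c d j"
    then have "luc a c d j mod m = 0" by simp
    then show False using assms(1,2) by (metis rangeI)
  qed
  then show ?thesis unfolding avoids_def rho_def
    using binrec_luc[of a c d] assms by (intro exI[of _ "luc a c d"] exI[of _ m]) auto
qed

text \<open>Modulo a the recurrence reads x_(n+2) = x_n, so the start 1, 1 stays constant.\<close>

lemma luc_1_1_mod: "[luc a 1 1 j = 1] (mod a)"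
proof (induction j rule: induct_nat_012)
  case (ge2 n)
  have "[a * luc a 1 1 (Suc n) + luc a 1 1 n = 0 + 1] (mod a)"
    using ge2 by (intro cong_add) (auto simp: cong_0_iff)
  then show ?case by simp
qed auto

lemma luc_1_1_mod_abs:
  assumes "\<bar>a\<bar> \<ge> 2" shows "luc a 1 1 j mod \<bar>a\<bar> = 1"
proof -
  have "[luc a 1 1 j = 1] (mod \<bar>a\<bar>)" using luc_1_1_mod by (simp add: cong_iff_dvd_diff)
  then show ?thesis using assms by (simp add: cong_def)
qed

lemma avoids_1: "\<bar>a\<bar> \<ge> 2 \<Longrightarrow> avoids a 1"
  by (rule avoidsI[of a 1 1 "\<bar>a\<bar>" "{1}"]) (auto simp: luc_1_1_mod_abs)

lemma avoids_2:
  assumes a: "\<bar>a\<bar> \<ge> 2" shows "avoids a 2"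
proof (rule avoidsI)
  let ?x = "luc a 1 1" and ?m = "2 * \<bar>a\<bar>"
  \<comment> \<open>Only two residues modulo 2 |a| lie over 1 modulo |a|; x_0 = 1 and x_2 = a + 1
    attain them.\<close>
  have "?x j mod ?m \<in> {1, 1 + \<bar>a\<bar>}" for j
  proof -
    have "?x j mod ?m = \<bar>a\<bar> * (?x j div \<bar>a\<bar> mod 2) + ?x j mod \<bar>a\<bar>"
      using zmod_zmult2_eq[of 2 "?x j" "\<bar>a\<bar>"] by (simp add: mult.commute)
    moreover have "?x j div \<bar>a\<bar> mod 2 = 0 \<or> ?x j div \<bar>a\<bar> mod 2 = 1" by auto
    ultimately show ?thesis using luc_1_1_mod_abs[OF a, of j] by auto
  qed
  moreover have "?x 0 mod ?m = 1" using a by simp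
  moreover have "?x 2 mod ?m = 1 + \<bar>a\<bar>"
  proof -
    have "[?x 2 = 1 + \<bar>a\<bar>] (mod ?m)"
      by (cases "a \<ge> 0") (auto simp: numeral_2_eq_2 cong_iff_dvd_diff)
    then show ?thesis using a by (simp add: cong_def)
  qed
  ultimately show "range (\<lambda>n. ?x n mod ?m) = {1, 1 + \<bar>a\<bar>}"
    by (intro equalityI image_subsetI insert_subsetI empty_subsetI) (blast | metis rangeI)+
qed (use a in auto)

text \<open>This case is outside both families: \<open>avoids_lucas\<close> excludes b = 2, and
  \<open>avoids_pell\<close> starts at h = 3.\<close>

lemma avoids_pell_4:
  assumes "a = 2 \<or> a = -2" shows "avoids a 4"
proof (rule avoidsI)
  show "range (\<lambda>n. luc a 1 1 n mod 5) = {1, 2, 3, 4}"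
    using assms
    by (elim disjE; subst range_luc_mod[where k = 12])
      (auto simp: eval_nat_numeral lessThan_Suc cong_def)
qed auto

text \<open>This count would be 2 h with h = 3, where the bound 2 U_h < V_h fails for b = 1.\<close>

lemma avoids_fib_6: "avoids 1 6" "avoids (-1) 6"
proof -
  have "range (\<lambda>n. luc 1 1 3 n mod 8) = {1, 2, 3, 4, 5, 7}"
    by (subst range_luc_mod[where k = 12]) (auto simp: eval_nat_numeral lessThan_Suc cong_def)
  then show "avoids 1 6" by (rule avoidsI) auto
  have "range (\<lambda>n. luc (-1) 1 2 n mod 8) = {1, 2, 3, 4, 5, 7}"
    by (subst range_luc_mod[where k = 12]) (auto simp: eval_nat_numeral lessThan_Suc cong_def)
  then show "avoids (-1) 6" by (rule avoidsI) auto
qed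

text \<open>Supplies the counts up to 3 for |a| = 1, where 0 is among the residues.\<close>

lemma rho_luc_small:
  assumes "a = 1 \<or> a = -1"
  shows "rho (luc a 0 0) 1 = 1" "rho (luc a 0 1) 2 = 2" "rho (luc a 0 1) 3 = 3"
proof -
  have "range (\<lambda>n. luc a 0 0 n mod 1) = {0}" by auto
  then show "rho (luc a 0 0) 1 = 1" by (simp add: rho_def)
  have "range (\<lambda>n. luc a 0 1 n mod 2) = {0, 1}"
    using assms by (elim disjE; subst range_luc_mod[where k = 3])
      (auto simp: eval_nat_numeral lessThan_Suc cong_def)
  then show "rho (luc a 0 1) 2 = 2" by (simp add: rho_def)
  have "range (\<lambda>n. luc a 0 1 n mod 3) = {0, 1, 2}"
    using assms by (elim disjE; subst range_luc_mod[where k = 8])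
      (auto simp: eval_nat_numeral lessThan_Suc cong_def)
  then show "rho (luc a 0 1) 3 = 3" by (simp add: rho_def)
qed

section \<open>At most three nonzero residues\<close>

text \<open>There is only one element of order two modulo m. If 2 u = m k with k even then m would
  divide u; so both quotients are odd and their difference is even.\<close>

lemma half_torsion_cong:
  fixes m u v :: int
  assumes "m dvd 2 * u" "m dvd 2 * v" "\<not> m dvd u" "\<not> m dvd v"
  shows "m dvd u - v"
proof -
  obtain k l where k: "2 * u = m * k" "2 * v = m * l" using assms(1,2) by (auto elim!: dvdE)
  have "odd k" using assms(3) k(1) by (auto elim!: evenE)
  moreover have "odd l" using assms(4) k(2) by (auto elim!: evenE)
  ultimately have "even (k - l)" by simp
  then obtain t where "k - l = 2 * t" by (elim evenE)
  then have "2 * (u - v) = 2 * (m * t)" using k by (metis mult.left_commute right_diff_distrib)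
  then have "u - v = m * t" by simp
  then show ?thesis by simp
qed

lemma avoids_fib_ge_4:
  assumes a: "a = 1 \<or> a = -1" and "avoids a n"
  shows "n \<ge> 4"
proof (rule ccontr)
  assume "\<not> n \<ge> 4"
  obtain x m where x: "binrec a x" "m \<ge> 1" "rho x m = n" "\<And>j. \<not> m dvd x j"
    using assms(2) unfolding avoids_def by blast
  have rec: "x (Suc (Suc j)) = a * x (Suc j) + x j" for j using x(1) by (simp add: binrec_def)
  \<comment> \<open>A difference of neighbours is again a term up to sign: x_(j-1) for a = 1, which
    requires j \<ge> 1, and -x_(j+2) for a = -1.\<close>
  have d1: "\<not> m dvd x (Suc j) - x j" if j: "j \<ge> 1" for j
  proof
    assume d: "m dvd x (Suc j) - x j"
    obtain i where i: "j = Suc i" using j by (cases j) auto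
    show False
    proof (cases "a = 1")
      case True
      then have "x (Suc j) - x j = x i" using rec[of i] i by simp
      then show False using d x(4) by metis
    next
      case False
      then have "x (Suc j) - x j = - x (Suc (Suc j))" using a rec[of j] by simp
      then show False using d x(4) by (metis dvd_minus_iff)
    qed
  qed
  have d2: "\<not> m dvd x (Suc (Suc j)) - x j" for j
    using rec[of j] a x(4)[of "Suc j"] by auto
  \<comment> \<open>Otherwise four consecutive terms would have four distinct residues.\<close>
  have per: "m dvd x (Suc (Suc (Suc j))) - x j" if "j \<ge> 1" for j
  proof (rule ccontr)
    assume d3: "\<not> m dvd x (Suc (Suc (Suc j))) - x j"
    let ?r = "\<lambda>i. x i mod m"
    have "?r (Suc j) \<noteq> ?r j" "?r (Suc (Suc j)) \<noteq> ?r (Suc j)" "?r (Suc (Suc (Suc j))) \<noteq> ?r (Suc (Suc j))"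
      "?r (Suc (Suc j)) \<noteq> ?r j" "?r (Suc (Suc (Suc j))) \<noteq> ?r (Suc j)" "?r (Suc (Suc (Suc j))) \<noteq> ?r j"
      using d1 d2 d3 that by (auto simp: mod_eq_dvd_iff simp del: One_nat_def)
    then have "card {?r j, ?r (Suc j), ?r (Suc (Suc j)), ?r (Suc (Suc (Suc j)))} = 4" by auto
    moreover have "card {?r j, ?r (Suc j), ?r (Suc (Suc j)), ?r (Suc (Suc (Suc j)))} \<le> rho x m"
      unfolding rho_def using rho_finite[OF x(2), of x] by (intro card_mono) auto
    ultimately show False using x(3) \<open>\<not> n \<ge> 4\<close> by simp
  qed
  \<comment> \<open>By the recurrence, x_(j+3) - x_j is 2 x_(j+1) for a = 1 and -2 x_(j+2) for a =
    -1; j = 1 and j = 2 give the witnesses 2 and 3.\<close>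
  have tor: "\<exists>i\<ge>1. m dvd 2 * x i \<and> m dvd 2 * x (Suc i)"
  proof (cases "a = 1")
    case True
    have "x (Suc (Suc (Suc j))) - x j = 2 * x (Suc j)" for j
      using rec[of j] rec[of "Suc j"] True by simp
    then have "m dvd 2 * x (Suc j)" if "j \<ge> 1" for j using per[OF that] by metis
    from this[of 1] this[of 2] show ?thesis by (intro exI[of _ 2]) (simp add: numeral_2_eq_2)
  next
    case False
    have "x (Suc (Suc (Suc j))) - x j = - (2 * x (Suc (Suc j)))" for j
      using rec[of j] rec[of "Suc j"] False a by simp
    then have "m dvd 2 * x (Suc (Suc j))" if "j \<ge> 1" for j
      using per[OF that] by (metis dvd_minus_iff)
    from this[of 1] this[of 2] show ?thesis by (intro exI[of _ 3]) (simp add: eval_nat_numeral)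
  qed
  then obtain i where "i \<ge> 1" "m dvd 2 * x (Suc i)" "m dvd 2 * x i" by blast
  then show False using half_torsion_cong x(4) d1 by blast
qed

section \<open>Assembling the cases\<close>

lemma avoids_odd:
  assumes s: "s = 1 \<or> s = -1" and b: "b \<ge> 1" and h: "odd h" "3 \<le> h" "b \<ge> 2 \<or> 5 \<le> h"
  shows "avoids (s * b) h" "avoids (s * b) (2 * h)"
proof -
  have ss: "s * s = 1" using s by auto
  have M: "V b h \<ge> 1" using V_pos[OF b, of h] by simp
  {
    obtain x where f: "binrec (s * b) x" "\<And>j. [x (j + h) = s * s * x j] (mod V b h)"
      "\<And>j. j < h \<Longrightarrow> [x j = pairval b h (s) j] (mod V b h) \<or> [x j = - pairval b h (s) j] (mod V b h)"
      by (rule odd_period_family[OF s s b h]) (rule that)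
    have "rho x (V b h) = h \<and> (\<forall>j. \<not> V b h dvd x j)"
    proof (rule rho_periodic)
      show "[x (j + h) = x j] (mod V b h)" for j using f(2)[of j] ss by simp
    qed (use pairval_bounds[OF b h s] pairval_inj[OF b h s] f(3) h in auto)
    then show "avoids (s * b) h" unfolding avoids_def using f(1) M by blast
  }
  {
    have s': "- s = 1 \<or> - s = -1" using s by auto
    obtain x where f: "binrec (s * b) x" "\<And>j. [x (j + h) = s * (- s) * x j] (mod V b h)"
      "\<And>j. j < h \<Longrightarrow> [x j = pairval b h (- s) j] (mod V b h) \<or> [x j = - pairval b h (- s) j] (mod V b h)"
      by (rule odd_period_family[OF s s' b h]) (rule that)
    have anti: "[x (j + h) = - x j] (mod V b h)" for j using f(2)[of j] ss by simp
    let ?A = "pairval b h (- s) ` {..<h}"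
    have sub: "\<exists>v\<in>?A. [x j = v] (mod V b h) \<or> [x j = - v] (mod V b h)" for j
    proof (induction j rule: less_induct)
      case (less j)
      show ?case
      proof (cases "j < h")
        case True
        then show ?thesis using f(3) by blast
      next
        case False
        then have lt: "j - h < j" using h by linarith
        have "[x j = - x (j - h)] (mod V b h)" using anti[of "j - h"] False by simp
        moreover obtain v where "v \<in> ?A" "[x (j - h) = v] (mod V b h) \<or> [x (j - h) = - v] (mod V b h)"
          using less[OF lt] by blast
        ultimately show ?thesis using cong_pm_trans by blast
      qed
    qed
    have "rho x (V b h) = 2 * card ?A \<and> (\<forall>j. \<not> V b h dvd x j)"
    proof (rule rho_symmetric[OF _ _ sub])
      show "\<exists>j. [x j = v] (mod V b h) \<or> [x j = - v] (mod V b h)" if "v \<in> ?A" for v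
        using that f(3) by blast
      show "\<exists>i. [x i = - x j] (mod V b h)" for j using anti by blast
    qed (use pairval_bounds[OF b h s'] in auto)
    moreover have "card ?A = h" using pairval_inj[OF b h s'] by (simp add: card_image)
    ultimately show "avoids (s * b) (2 * h)" unfolding avoids_def using f(1) M by auto
  }
qed

lemma avoids_all:
  assumes n: "\<bar>a\<bar> = 1 \<and> n \<ge> 4 \<or> \<bar>a\<bar> \<ge> 2 \<and> n \<ge> 1"
  shows "avoids a n"
proof -
  define s b where "s = sgn a" and "b = \<bar>a\<bar>"
  have s: "s = 1 \<or> s = -1" and b: "b \<ge> 1" and a: "a = s * b"
    using n unfolding s_def b_def by (auto simp: sgn_if abs_if split: if_splits)
  have bn: "b = 1 \<and> n \<ge> 4 \<or> b \<ge> 2" using n b_def by auto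
  \<comment> \<open>The three cases match the counts h, 2 h and 2 (h + 1) with h odd.\<close>
  consider "odd n" | k where "n = 2 * k" "odd k" | k where "n = 2 * (k + 1)" "odd k"
  proof (cases "odd n")
    case False
    then obtain k where k: "n = 2 * k" by (auto elim: evenE)
    show ?thesis
    proof (cases "odd k")
      case False
      then have "k \<noteq> 0" using n k by auto
      then obtain l where "k = l + 1" by (metis Suc_eq_plus1 not0_implies_Suc)
      then show ?thesis using that(3)[of l] k False by simp
    qed (use that k in blast)
  qed (use that in blast)
  then show ?thesis
  proof cases
    case 1
    show ?thesis
    proof (cases "n = 1")
      case True
      then show ?thesis using avoids_1[of a] bn unfolding b_def by auto
    next
      case False
      then have "3 \<le> n" "b \<ge> 2 \<or> 5 \<le> n" using 1 bn by presburger+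
      then show ?thesis unfolding a by (intro avoids_odd(1) s b 1)
    qed
  next
    case (2 k)
    show ?thesis
    \<comment> \<open>The exceptions to the family are n = 2 and, for b = 1, n = 6.\<close>
    proof (cases "k = 1 \<or> b = 1 \<and> k = 3")
      case True
      then show ?thesis
      proof
        assume k1: "k = 1"
        then have "b \<ge> 2" using bn 2(1) by simp
        then show ?thesis using avoids_2[of a] k1 2(1) unfolding b_def by simp
      next
        assume bk: "b = 1 \<and> k = 3"
        show ?thesis using s unfolding a 2(1) by (elim disjE) (simp_all add: bk avoids_fib_6)
      qed
    next
      case False
      then have "3 \<le> k" "b \<ge> 2 \<or> 5 \<le> k" using 2 bn by presburger+
      then show ?thesis unfolding a 2(1) by (intro avoids_odd(2) s b 2(2))
    qed
  next
    case (3 k)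
    show ?thesis
    proof (cases "b = 2")
      case True
      show ?thesis
      proof (cases "k = 1")
        case k1: True
        then show ?thesis using avoids_pell_4[of a] True 3(1) s unfolding a by auto
      next
        case False
        then have "k \<ge> 3" using 3 by presburger
        then show ?thesis unfolding a True 3(1) by (intro avoids_pell s 3(2))
      qed
    qed (unfold a 3(1), intro avoids_lucas s b 3(2))
  qed
qed

theorem theorem1:
  fixes a1 :: int
  assumes "a1 \<noteq> 0"
  defines "f \<equiv> [:-1, -a1, 1:]"
  shows "Rset f = {n. n \<ge> 1}
    \<and> (\<forall>n::nat. n \<ge> 1 \<longrightarrow>
         ((\<exists>x m. x \<in> LRS f \<and> m \<ge> 1 \<and> rho x m = n \<and> (\<forall>j. \<not> m dvd x j))
          \<longleftrightarrow> ((\<bar>a1\<bar> = 1 \<and> n \<ge> 4) \<or> \<bar>a1\<bar> \<ge> 2)))"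
proof -
  have av: "(\<exists>x m. x \<in> LRS f \<and> m \<ge> 1 \<and> rho x m = n \<and> (\<forall>j. \<not> m dvd x j)) \<longleftrightarrow> avoids a1 n" for n
    unfolding avoids_def f_def LRS_iff_binrec ..
  have iff: "avoids a1 n \<longleftrightarrow> (\<bar>a1\<bar> = 1 \<and> n \<ge> 4) \<or> \<bar>a1\<bar> \<ge> 2" if "n \<ge> 1" for n
  proof
    assume "avoids a1 n"
    moreover have "a1 = 1 \<or> a1 = -1 \<or> \<bar>a1\<bar> \<ge> 2" using assms(1) by linarith
    ultimately show "(\<bar>a1\<bar> = 1 \<and> n \<ge> 4) \<or> \<bar>a1\<bar> \<ge> 2" using avoids_fib_ge_4[of a1 n] by auto
  qed (use avoids_all that in auto)
  have "Rset f = {n. n \<ge> 1}"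
  proof (intro equalityI subsetI)
    fix n assume "n \<in> Rset f"
    then obtain x m where "n = rho x m" "m \<ge> 1" unfolding Rset_def by blast
    then show "n \<in> {n. n \<ge> 1}" using rho_finite[of m x] by (simp add: rho_def Suc_le_eq card_gt_0_iff)
  next
    fix n :: nat assume "n \<in> {n. n \<ge> 1}"
    then have n: "n \<ge> 1" by simp
    show "n \<in> Rset f"
    proof (cases "(\<bar>a1\<bar> = 1 \<and> n \<ge> 4) \<or> \<bar>a1\<bar> \<ge> 2")
      case True
      then show ?thesis using iff[OF n] av[of n] unfolding Rset_def by blast
    next
      case False
      \<comment> \<open>In this range 0 cannot be avoided, so explicit sequences containing it are
        used.\<close>
      then have "a1 = 1 \<or> a1 = -1" "n = 1 \<or> n = 2 \<or> n = 3" using assms(1) n by auto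
      then obtain c d m where "m \<ge> 1" "rho (luc a1 c d) m = n" 
        using rho_luc_small[of a1] by (metis one_le_numeral order_refl)
      moreover have "luc a1 c d \<in> LRS f" unfolding f_def LRS_iff_binrec by (rule binrec_luc)
      ultimately show ?thesis unfolding Rset_def by blast
    qed
  qed
  then show ?thesis using av iff by blast
qed

end
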